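(* Let $q$ be a prime power, $k\ge 2$, $N\ge k$ and $n$ be positive integers, and let $(n,d_1,\ldots,d_{k-1})$ be such that a generalised arc of order $k-2$ with $N$ elements and parameters $(n,d_1,\ldots,d_{k-1})$ exists in $PG(n,q)$. In $PG(n+1,q)$ select an $n$-dimensional subspace $\Pi$ as the secret. In $\Pi$ select a generalised arc $\mathcal{A}$ of order $k-2$ with $N$ elements and parameters $(n,d_1,\ldots,d_{k-1})$. The $N$ elements of $\mathcal{A}$ are the shares. This describes a $k$-out-of-$N$ secret sharing scheme with the attack probabilities $$p_i=\frac{q-1}{q^{n+1-d_i}-1}\qquad (0\le i<k),$$ where formally $d_0=-1$.
   Context: All dimensions are projective (the empty subspace has dimension $-1$). A generalised arc of order $d$ with parameters $(n,n_1,\ldots,n_{d+1})$, $-1<n_1<n_2<\cdots<n_{d+1}<n$, in $PG(n,q)$ is a set of $n_1$-dimensional subspaces of $PG(n,q)$ such that each $j$ of them generate a subspace of dimension $n_j$ ($1\le j\le d+1$), and each $d+2$ of them span $PG(n,q)$. A $k$-out-of-$N$ secret sharing scheme: a dealer generates $N$ shares and a secret, and the shares are given to $N$ different participants; each $k$ participants can reconstruct the secret from their shares, and fewer than $k$ participants cannot. The attack probability $p_i$ ($i<k$) is the (maximal) probability with which $i$ participants, knowing only their $i$ shares and all public data, can guess the secret correctly. Here the public data are $q,n,k,N$ and the parameters $(n,d_1,\ldots,d_{k-1})$, and "select" means: the pair consisting of $\Pi$ and the arc, as an $N$-tuple $(\pi_1,\ldots,\pi_N)$ of its elements, is chosen uniformly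 at random among all admissible choices. *)

theory Defs
  imports "HOL-Probability.Probability"
begin

text \<open>
  The projective space \<open>PG(m - 1, q)\<close> is the lattice of linear subspaces of
  \<open>'a ^ 'm\<close>, where \<open>'a\<close> is a field with \<open>q\<close> elements and \<open>m = CARD('m)\<close>.
  The empty projective subspace is \<open>{0}\<close>, of projective dimension \<open>-1\<close>.
\<close>

definition pdim :: "('a::field ^ 'm) set \<Rightarrow> int" where
  "pdim S = int (vec.dim S) - 1"

text \<open>
  Generalised arcs of order \<open>r\<close> with parameters \<open>(n, d 1, \<dots>, d (r + 1))\<close> in the
  \<open>n\<close>-dimensional projective space \<open>W\<close>, which may be a subspace of a larger one.
  Other values of \<open>d\<close>, in particular \<open>d 0\<close>, are irrelevant.
\<close>

definition generalised_arc ::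
  "('a::field ^ 'm) set \<Rightarrow> nat \<Rightarrow> int \<Rightarrow> (nat \<Rightarrow> int) \<Rightarrow> ('a ^ 'm) set set \<Rightarrow> bool" where
  "generalised_arc W r n d A \<longleftrightarrow>
     vec.subspace W \<and> pdim W = n \<and>
     -1 < d 1 \<and> (\<forall>j\<in>{1..r}. d j < d (j + 1)) \<and> d (r + 1) < n \<and>
     (\<forall>X\<in>A. vec.subspace X \<and> X \<subseteq> W \<and> pdim X = d 1) \<and>
     (\<forall>j\<in>{1..r + 1}. \<forall>B\<subseteq>A. card B = j \<longrightarrow> pdim (vec.span (\<Union>B)) = d j) \<and>
     (\<forall>B\<subseteq>A. card B = r + 2 \<longrightarrow> vec.span (\<Union>B) = W)"

text \<open>
  The dealer is a joint distribution of a secret and a share for each participant.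
  A coalition \<open>I\<close> sees \<open>restrict x I\<close>. Fewer than \<open>k\<close> participants cannot
  reconstruct the secret: whatever shares they hold, at least two secrets are
  compatible with them.
\<close>

definition secret_sharing_scheme ::
  "nat \<Rightarrow> nat \<Rightarrow> 'p set \<Rightarrow> ('s \<times> ('p \<Rightarrow> 'h)) pmf \<Rightarrow> bool" where
  "secret_sharing_scheme k N P D \<longleftrightarrow>
     finite P \<and> card P = N \<and>
     (\<forall>I\<subseteq>P. card I = k \<longrightarrow>
        (\<exists>f. \<forall>(s, x)\<in>set_pmf D. f (restrict x I) = s)) \<and>
     (\<forall>I\<subseteq>P. card I < k \<longrightarrow>
        (\<forall>(s, x)\<in>set_pmf D. \<exists>(s', x')\<in>set_pmf D. restrict x' I = restrict x I \<and> s' \<noteq> s))"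

text \<open>
  A guessing strategy \<open>g\<close> may be randomised.
\<close>

definition success_prob ::
  "('s \<times> ('p \<Rightarrow> 'h)) pmf \<Rightarrow> 'p set \<Rightarrow> (('p \<Rightarrow> 'h) \<Rightarrow> 's pmf) \<Rightarrow> real" where
  "success_prob D I g =
     pmf (do { (s, x) \<leftarrow> D; t \<leftarrow> g (restrict x I); return_pmf (t = s) }) True"

definition attack_prob ::
  "('s \<times> ('p \<Rightarrow> 'h)) pmf \<Rightarrow> 'p set \<Rightarrow> nat \<Rightarrow> real" where
  "attack_prob D P i =
     (SUP (I, g) \<in> {I. I \<subseteq> P \<and> card I = i} \<times> UNIV. success_prob D I g)"

text \<open>
  The secret is an \<open>n\<close>-dimensional subspace \<open>S\<close>; participant \<open>j \<in> {1..N}\<close> receives \<open>x j\<close>.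
  Extensionality makes \<open>x\<close> represent an \<open>N\<close>-tuple.
\<close>

definition arc_choices ::
  "nat \<Rightarrow> nat \<Rightarrow> nat \<Rightarrow> (nat \<Rightarrow> int) \<Rightarrow>
   (('a::field ^ 'm) set \<times> (nat \<Rightarrow> ('a ^ 'm) set)) set" where
  "arc_choices n k N d =
     {(S, x). vec.subspace S \<and> pdim S = int n \<and>
        x \<in> extensional {1..N} \<and> inj_on x {1..N} \<and>
        generalised_arc S (k - 2) (int n) d (x ` {1..N})}"

definition arc_scheme ::
  "nat \<Rightarrow> nat \<Rightarrow> nat \<Rightarrow> (nat \<Rightarrow> int) \<Rightarrow>
   (('a::{field,finite} ^ 'm) set \<times> (nat \<Rightarrow> ('a ^ 'm) set)) pmf" where
  "arc_scheme n k N d = pmf_of_set (arc_choices n k N d)"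

end

theory Submission imports Defs begin

text \<open>
  Any \<open>k\<close> shares span the secret hyperplane \<open>\<Pi>\<close>, by the definition of an arc of order \<open>k - 2\<close>.
  A coalition of \<open>i < k\<close> participants knows a subspace \<open>U\<close> of dimension \<open>d i < n\<close>, the span of its
  shares, and knows that \<open>\<Pi>\<close> contains \<open>U\<close>. That it knows nothing more is a matter of symmetry: for
  hyperplanes \<open>S\<close> and \<open>T\<close> above \<open>U\<close> there is a linear automorphism that fixes \<open>U\<close> pointwise and maps
  \<open>S\<close> to \<open>T\<close> (\<open>linear_automorphism_fixing_subspace\<close>). It maps the arcs in \<open>S\<close> that contain the
  known shares injectively to arcs in \<open>T\<close> that contain the same shares. Hence, once a single such arc
  exists, every hyperplane above \<open>U\<close> is a possible secret (\<open>compatible_arc_secrets\<close>), and all of them have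
  equally many completions to an arc (\<open>card_completions_le\<close>). As \<open>\<Pi>\<close> and the arc are chosen uniformly,
  the secret is uniformly distributed, given the shares, among the hyperplanes above \<open>U\<close>.

  Against such a posterior distribution the best strategy is to name any compatible secret, and it succeeds
  with probability one over their number (\<open>attack_prob_equidistributed\<close>). There are
  \<open>(q ^ (n + 1 - d i) - 1) / (q - 1)\<close> hyperplanes above \<open>U\<close> (\<open>card_hyperplanes_above\<close>), which gives the
  attack probability; the number exceeds \<open>1\<close> because \<open>d i < n\<close>, so the secret cannot be reconstructed.
\<close>

section \<open>Subspaces over a finite field\<close>

text \<open>
  The pointwise stabiliser of \<open>U\<close> in the general linear group acts transitively on the subspaces of a
  given dimension that contain \<open>U\<close>.
\<close>

lemma linear_automorphism_fixing_subspace: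
  fixes U S T :: "('a::field ^ 'm::finite) set"
  assumes U: "vec.subspace U" and S: "vec.subspace S" and T: "vec.subspace T"
    and US: "U \<subseteq> S" and UT: "U \<subseteq> T" and dim: "vec.dim S = vec.dim T"
  obtains f where "Vector_Spaces.linear (*s) (*s) f" "inj f" "\<And>u. u \<in> U \<Longrightarrow> f u = u" "f ` S = T"
proof -
  obtain B where B: "B \<subseteq> U" "vec.independent B" "vec.span B = U"
    using vec.basis_subspace_exists[OF U] by metis
  obtain BS where BS: "B \<subseteq> BS" "BS \<subseteq> S" "vec.independent BS" "S \<subseteq> vec.span BS"
    using vec.maximal_independent_subset_extend[OF order_trans[OF B(1) US] B(2)] by metis
  obtain BT where BT: "B \<subseteq> BT" "BT \<subseteq> T" "vec.independent BT" "T \<subseteq> vec.span BT"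
    using vec.maximal_independent_subset_extend[OF order_trans[OF B(1) UT] B(2)] by metis
  have fin: "finite BS" "finite BT"
    by (rule vec.finiteI_independent[OF BS(3)], rule vec.finiteI_independent[OF BT(3)])
  have "card BS = card BT"
    using vec.basis_card_eq_dim[OF BS(2,4,3)] vec.basis_card_eq_dim[OF BT(2,4,3)] dim by simp
  then have "card (BS - B) = card (BT - B)"
    using BS(1) BT(1) fin by (simp add: card_Diff_subset finite_subset)
  then obtain h where h: "bij_betw h (BS - B) (BT - B)"
    using finite_same_card_bij[OF finite_Diff[OF fin(1)] finite_Diff[OF fin(2)]] by metis
  \<comment> \<open>Keep the common basis \<open>B\<close> of \<open>U\<close> pointwise and match the remaining basis vectors of \<open>S\<close> and \<open>T\<close>.\<close>
  define h' where "h' x = (if x \<in> B then x else h x)" for x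
  have "bij_betw h' (B \<union> (BS - B)) (B \<union> (BT - B))"
  proof (rule bij_betw_combine)
    show "bij_betw h' B B"
      by (auto simp: h'_def bij_betw_def inj_on_def)
    show "bij_betw h' (BS - B) (BT - B)"
      using h by (rule bij_betw_cong[THEN iffD1, rotated]) (simp add: h'_def)
    show "B \<inter> (BT - B) = {}" by blast
  qed
  then have h': "bij_betw h' BS BT"
    using BS(1) BT(1) by (simp add: Un_absorb1)
  then obtain f where f: "Vector_Spaces.linear (*s) (*s) f" "inj f" "\<forall>x\<in>BS. f x = h' x"
    using vec.linear_independent_extend_inj[of BS h'] BS(3) BT(3)
    unfolding bij_betw_def by metis
  interpret f: Vector_Spaces.linear "(*s)" "(*s)" f by (fact f(1))
  have "f u = u" if "u \<in> U" for u
  proof -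
    have "u \<in> vec.span B" using that B(3) by simp
    then show ?thesis
    proof (rule vec.linear_eq_on[OF f(1) vec.linear_ident])
      fix b assume "b \<in> B"
      then show "f b = b" using f(3) BS(1) by (auto simp: h'_def)
    qed
  qed
  moreover have "f ` S = T"
  proof -
    have "f ` BS = h' ` BS" using f(3) by (intro image_cong) auto
    also have "\<dots> = BT" using h' by (simp add: bij_betw_def)
    finally have "f ` vec.span BS = vec.span BT" by (simp flip: f.span_image)
    moreover have "vec.span BS = S"
      using BS(2,4) S by (rule vec.span_subspace)
    moreover have "vec.span BT = T"
      using BT(2,4) T by (rule vec.span_subspace)
    ultimately show ?thesis by simp
  qed
  ultimately show ?thesis using that f by blast
qed

lemma card_field_ge_2: "CARD('a::{field,finite}) \<ge> 2"
  using card_mono[of UNIV "{0, 1 :: 'a}"] by simp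

lemma card_span_insert:
  fixes b :: "'a::{field,finite} ^ 'm::finite"
  assumes "b \<notin> vec.span B"
  shows "card (vec.span (insert b B)) = CARD('a) * card (vec.span B)"
proof -
  have "bij_betw (\<lambda>(c, v). v + c *s b) (UNIV \<times> vec.span B) (vec.span (insert b B))"
    unfolding bij_betw_def
  proof
    show "inj_on (\<lambda>(c, v). v + c *s b) (UNIV \<times> vec.span B)"
    proof (clarsimp simp: inj_on_def)
      fix c v c' v' assume v: "v \<in> vec.span B" "v' \<in> vec.span B" and eq: "v + c *s b = v' + c' *s b"
      have e: "(c - c') *s b = v' - v"
        using eq by (simp add: vector_sub_rdistrib algebra_simps)
      have "c = c'"
      proof (rule ccontr)
        assume "c \<noteq> c'"
        then have "b = inverse (c - c') *s ((c - c') *s b)"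
          unfolding vec.scale_scale by simp
        then have "b = inverse (c - c') *s (v' - v)"
          unfolding e .
        then show False
          using assms v by (metis vec.span_diff vec.span_scale)
      qed
      then show "c = c' \<and> v = v'" using eq by simp
    qed
    show "(\<lambda>(c, v). v + c *s b) ` (UNIV \<times> vec.span B) = vec.span (insert b B)"
    proof (intro equalityI subsetI)
      fix x assume "x \<in> vec.span (insert b B)"
      then obtain k where "x - k *s b \<in> vec.span B"
        by (auto simp: vec.span_insert)
      then show "x \<in> (\<lambda>(c, v). v + c *s b) ` (UNIV \<times> vec.span B)"
        by (intro image_eqI[of _ _ "(k, x - k *s b)"]) auto
    next
      fix x assume "x \<in> (\<lambda>(c, v). v + c *s b) ` (UNIV \<times> vec.span B)"
      then obtain c v where "x = v + c *s b" "v \<in> vec.span B" by auto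
      then have "x - c *s b \<in> vec.span B" by simp
      then show "x \<in> vec.span (insert b B)"
        unfolding vec.span_insert by blast
    qed
  qed
  then show ?thesis
    by (metis bij_betw_same_card card_cartesian_product)
qed

lemma card_subspace:
  fixes S :: "('a::{field,finite} ^ 'm::finite) set"
  assumes "vec.subspace S"
  shows "card S = CARD('a) ^ vec.dim S"
proof -
  have "card (vec.span B) = CARD('a) ^ card B" if "finite B" "vec.independent B"
    for B :: "('a ^ 'm) set"
    using that
  proof (induction B rule: finite_induct)
    case (insert b B)
    then have "b \<notin> vec.span B" "vec.independent B"
      by (auto simp: vec.independent_insert)
    with insert show ?case by (simp add: card_span_insert)
  qed simp
  then show ?thesis
    using vec.basis_subspace_exists[OF assms] by metis
qed

text \<open>
  The hyperplanes above \<open>U\<close> are the points of the dual of the quotient by \<open>U\<close>, hence their number is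
  \<open>(q ^ c - 1) / (q - 1)\<close> with \<open>c\<close> the codimension of \<open>U\<close>. Inside the given space, double counting of
  the pairs of a hyperplane \<open>S\<close> above \<open>U\<close> and a vector of \<open>S - U\<close> reduces codimension \<open>c + 1\<close> to \<open>c\<close>, and in codimension \<open>1\<close> only \<open>U\<close> itself counts. The factor \<open>q - 1\<close>
  stays on the left to avoid division of natural numbers.
\<close>

lemma card_hyperplanes_above:
  fixes U :: "('a::{field,finite} ^ 'm::finite) set"
  assumes "vec.subspace U" and "vec.dim U < CARD('m)"
  shows "card {S. vec.subspace S \<and> vec.dim S = CARD('m) - 1 \<and> U \<subseteq> S} * (CARD('a) - 1)
    = CARD('a) ^ (CARD('m) - vec.dim U) - 1"
  using assms
proof (induction "CARD('m) - 1 - vec.dim U" arbitrary: U)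
  case 0
  then have "vec.dim U = CARD('m) - 1" by simp
  moreover from this have "S = U" if "vec.subspace S" "vec.dim S = CARD('m) - 1" "U \<subseteq> S" for S
    using vec.subspace_dim_equal[OF 0(2) that(1,3)] that(2) by simp
  ultimately have "{S. vec.subspace S \<and> vec.dim S = CARD('m) - 1 \<and> U \<subseteq> S} = {U}"
    using 0(2) by blast
  moreover have "CARD('m) - vec.dim U = 1"
    using 0 by simp
  ultimately show ?case by simp
next
  case (Suc c)
  define q m u where "q = CARD('a)" and "m = CARD('m)" and "u = vec.dim U"
  define H where "H V = {S :: ('a ^ 'm) set. vec.subspace S \<and> vec.dim S = m - 1 \<and> V \<subseteq> S}" for V
  have c: "c = m - 1 - Suc u" "Suc u < m" "m - u = Suc (Suc c)" "m = Suc (Suc c) + u" "m - 1 = Suc c + u"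
    using Suc.hyps(2) by (auto simp: m_def u_def)
  have "q \<ge> 2"
    unfolding q_def by (rule card_field_ge_2)
  have card_UNIV: "card (UNIV :: ('a ^ 'm) set) = q ^ m"
    by (simp add: q_def m_def)
  have card_compl: "card (- V) = q ^ m - q ^ vec.dim V" if "vec.subspace V" for V :: "('a ^ 'm) set"
    using that card_subspace[of V] card_UNIV by (simp add: Compl_eq_Diff_UNIV card_Diff_subset q_def)
  \<comment> \<open>For \<open>v\<close> outside \<open>U\<close>, the hyperplanes through \<open>U\<close> and \<open>v\<close>
    are those above a subspace one dimension larger.\<close>
  have through: "card {S \<in> H U. v \<in> S} * (q - 1) = q ^ Suc c - 1" if "v \<in> - U" for v
  proof -
    let ?V = "vec.span (insert v U)"
    have "vec.span U = U"
      using Suc.prems(1) by (rule vec.span_eq_iff[THEN iffD2])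
    then have "v \<notin> vec.span U" using that by (simp only: Compl_iff not_False_eq_True)
    then have dim: "vec.dim ?V = Suc u"
      by (simp add: vec.dim_insert u_def)
    then have "c = CARD('m) - 1 - vec.dim ?V" "vec.dim ?V < CARD('m)"
      using c by (simp_all add: m_def)
    from Suc.hyps(1)[OF this(1) vec.subspace_span this(2)]
    have "card (H ?V) * (q - 1) = q ^ (m - vec.dim ?V) - 1"
      by (simp only: H_def q_def m_def)
    moreover have "?V \<subseteq> S \<longleftrightarrow> v \<in> S \<and> U \<subseteq> S" if "vec.subspace S" for S
      using vec.span_minimal[OF _ that] vec.span_superset insert_subset order_trans by metis
    then have "{S \<in> H U. v \<in> S} = H ?V"
      unfolding H_def by auto
    moreover have "m - vec.dim ?V = Suc c"
      using dim c by simp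
    ultimately show ?thesis by simp
  qed
  \<comment> \<open>Count the pairs \<open>(v, S)\<close> with \<open>v \<in> S - U\<close> in both orders.\<close>
  have "(\<Sum>v\<in>- U. card {S \<in> H U. v \<in> S}) = (\<Sum>S\<in>H U. card {v \<in> - U. v \<in> S})"
    by (rule sum_multicount_gen) auto
  also have "\<dots> = (\<Sum>S\<in>H U. q ^ (m - 1) - q ^ u)"
  proof (rule sum.cong[OF refl])
    fix S assume S: "S \<in> H U"
    have "{v \<in> - U. v \<in> S} = S - U" by auto
    then show "card {v \<in> - U. v \<in> S} = q ^ (m - 1) - q ^ u"
      using S Suc.prems(1) by (simp add: H_def card_Diff_subset card_subspace q_def u_def)
  qed
  finally have "card (H U) * (q ^ (m - 1) - q ^ u) * (q - 1) = (\<Sum>v\<in>- U. card {S \<in> H U. v \<in> S} * (q - 1))"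
    by (simp flip: sum_distrib_right)
  also have "\<dots> = (q ^ m - q ^ u) * (q ^ Suc c - 1)"
    using through card_compl[OF Suc.prems(1)] by (simp add: u_def)
  also have "q ^ m - q ^ u = q ^ u * (q ^ (m - u) - 1)"
    using c by (simp add: power_add algebra_simps)
  also have "q ^ (m - 1) - q ^ u = q ^ u * (q ^ Suc c - 1)"
    using c by (simp add: power_add algebra_simps)
  finally have "(q ^ u * (q ^ Suc c - 1)) * (card (H U) * (q - 1)) = (q ^ u * (q ^ Suc c - 1)) * (q ^ (m - u) - 1)"
    by (simp only: mult_ac)
  moreover have "q ^ u * (q ^ Suc c - 1) \<noteq> 0"
    using \<open>q \<ge> 2\<close> one_less_power[of q "Suc c"] by auto
  ultimately show ?case
    unfolding H_def q_def m_def u_def by simp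
qed


section \<open>Generalised arcs\<close>

text \<open>
  Arcs are described by inclusions, spans and dimensions only, which injective linear maps respect.
\<close>

lemma generalised_arc_image:
  fixes f :: "'a::field ^ 'l::finite \<Rightarrow> 'a ^ 'm::finite"
  assumes lin: "Vector_Spaces.linear (*s) (*s) f" and inj: "inj f"
    and arc: "generalised_arc W r n d A"
  shows "generalised_arc (f ` W) r n d ((`) f ` A)"
proof -
  interpret f: Vector_Spaces.linear "(*s)" "(*s)" f by (fact lin)
  have dim: "pdim (f ` X) = pdim X" for X
    using vec.dim_image_eq[OF lin inj_on_subset[OF inj], of X] by (simp add: pdim_def)
  have span: "vec.span (\<Union>((`) f ` B)) = f ` vec.span (\<Union>B)" for B
    by (simp add: f.span_image flip: image_Union)
  have sub: "\<exists>B\<subseteq>A. B' = (`) f ` B \<and> card B = card B'" if B': "B' \<subseteq> (`) f ` A" for B'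
  proof -
    obtain B where B: "B \<subseteq> A" "B' = (`) f ` B"
      using B' by (auto simp: subset_image_iff)
    have "inj_on ((`) f) B"
      by (simp add: inj_on_def inj_image_eq_iff[OF inj])
    then have "card B' = card B"
      unfolding B(2) by (rule card_image)
    with B show ?thesis by metis
  qed
  have "pdim (vec.span (\<Union>B')) = d j" if "j \<in> {1..r + 1}" "B' \<subseteq> (`) f ` A" "card B' = j" for B' j
    using sub[OF that(2)] that(1,3) arc span dim by (auto simp: generalised_arc_def)
  moreover have "vec.span (\<Union>B') = f ` W" if "B' \<subseteq> (`) f ` A" "card B' = r + 2" for B'
    using sub[OF that(1)] that(2) arc span by (auto simp: generalised_arc_def)
  ultimately show ?thesis
    using arc f.subspace_image dim unfolding generalised_arc_def by (auto simp: image_mono)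
qed

lemma generalised_arc_less_top:
  assumes "generalised_arc W r n d A" and "1 \<le> j" and "j \<le> r + 1"
  shows "d j < n"
  using assms(3,2)
proof (induction rule: inc_induct)
  case base
  then show ?case using assms(1) by (simp add: generalised_arc_def)
next
  case (step j)
  then have "d j < d (j + 1)" using assms(1) by (simp add: generalised_arc_def)
  with step show ?case by simp
qed


section \<open>Guessing a uniformly distributed secret\<close>

text \<open>
  The support of the conditional distribution of the secret, given the shares \<open>y\<close> of \<open>I\<close>,
  when \<open>C\<close> is the support of the joint distribution.
\<close>

definition compatible_secrets :: "('s \<times> ('p \<Rightarrow> 'h)) set \<Rightarrow> 'p set \<Rightarrow> ('p \<Rightarrow> 'h) \<Rightarrow> 's set" where
  "compatible_secrets C I y = {s. \<exists>x. (s, x) \<in> C \<and> restrict x I = y}"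

lemma success_prob_pmf_of_set:
  assumes "finite C" "C \<noteq> {}"
  shows "success_prob (pmf_of_set C) I g =
    (\<Sum>(s, x)\<in>C. pmf (g (restrict x I)) s) / real (card C)"
proof -
  have "pmf (g (restrict x I) \<bind> (\<lambda>t. return_pmf (t = s))) True = pmf (g (restrict x I)) s" for s x
    by (simp add: pmf_map vimage_def measure_pmf_single flip: map_pmf_def)
  then show ?thesis
    unfolding success_prob_def using assms
    by (subst pmf_bind_pmf_of_set) (auto simp: case_prod_beta intro!: sum.cong)
qed

text \<open>
  If the conditional distribution of the secret, given the shares of \<open>I\<close>, is uniform on a set of \<open>h\<close>
  compatible secrets, then a guess succeeds with probability \<open>1 / h\<close> whenever it lies in this set, and
  never otherwise. The right-hand side is the average probability of guessing a compatible secret.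
\<close>

lemma success_prob_equidistributed:
  fixes C :: "('s \<times> ('p \<Rightarrow> 'h)) set"
  assumes C: "finite C" "C \<noteq> {}"
    and card_secrets: "\<And>s x. (s, x) \<in> C \<Longrightarrow> card (compatible_secrets C I (restrict x I)) = h"
    and equal: "\<And>y s s'. s \<in> compatible_secrets C I y \<Longrightarrow> s' \<in> compatible_secrets C I y \<Longrightarrow>
      card {x. (s, x) \<in> C \<and> restrict x I = y} = card {x. (s', x) \<in> C \<and> restrict x I = y}"
  shows "real h * success_prob (pmf_of_set C) I g =
    (\<Sum>(s, x)\<in>C. measure_pmf.prob (g (restrict x I)) (compatible_secrets C I (restrict x I))) / real (card C)"
proof -
  let ?F = "compatible_secrets C I"
  define Y where "Y = (\<lambda>c. restrict (snd c) I) ` C"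
  have group: "(\<Sum>c\<in>C. w c) = (\<Sum>y\<in>Y. \<Sum>s\<in>?F y. \<Sum>x\<in>{x. (s, x) \<in> C \<and> restrict x I = y}. w (s, x))"
    for w :: "'s \<times> ('p \<Rightarrow> 'h) \<Rightarrow> real"
  proof -
    have "(\<Sum>c\<in>C. w c) = (\<Sum>y\<in>Y. \<Sum>c\<in>{c \<in> C. restrict (snd c) I = y}. w c)"
      unfolding Y_def by (rule sum.image_gen[OF C(1)])
    also have "\<dots> = (\<Sum>y\<in>Y. \<Sum>(s, x)\<in>Sigma (?F y) (\<lambda>s. {x. (s, x) \<in> C \<and> restrict x I = y}). w (s, x))"
      by (intro sum.cong) (auto simp: compatible_secrets_def)
    also have "\<dots> = (\<Sum>y\<in>Y. \<Sum>s\<in>?F y. \<Sum>x\<in>{x. (s, x) \<in> C \<and> restrict x I = y}. w (s, x))"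
    proof (intro sum.cong refl sum.Sigma[symmetric] ballI)
      fix y
      have "?F y \<subseteq> fst ` C" by (force simp: compatible_secrets_def)
      then show "finite (?F y)" using C(1) finite_surj by blast
      fix s
      have "{x. (s, x) \<in> C \<and> restrict x I = y} \<subseteq> snd ` C" by force
      then show "finite {x. (s, x) \<in> C \<and> restrict x I = y}" using C(1) finite_surj by blast
    qed
    finally show ?thesis .
  qed
  \<comment> \<open>For fixed shares \<open>y\<close>, all secrets in \<open>?F y\<close> carry the same weight \<open>M\<close>, so
    both sides are \<open>h * M\<close> times the probability that \<open>g y\<close> hits \<open>?F y\<close>.\<close>
  have "real h * (\<Sum>s\<in>?F y. \<Sum>x\<in>{x. (s, x) \<in> C \<and> restrict x I = y}. pmf (g y) s)
    = (\<Sum>s\<in>?F y. \<Sum>x\<in>{x. (s, x) \<in> C \<and> restrict x I = y}. measure_pmf.prob (g y) (?F y))"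
    if "y \<in> Y" for y
  proof -
    from that obtain s0 x0 where y: "y = restrict x0 I" "(s0, x0) \<in> C"
      by (auto simp: Y_def)
    then have s0: "s0 \<in> ?F y" by (auto simp: compatible_secrets_def)
    have fin: "finite (?F y)"
      using C(1) by (rule finite_surj[of _ _ fst]) (force simp: compatible_secrets_def)
    define M where "M = card {x. (s0, x) \<in> C \<and> restrict x I = y}"
    have M: "card {x. (s, x) \<in> C \<and> restrict x I = y} = M" if "s \<in> ?F y" for s
      using equal[OF that s0] by (simp add: M_def)
    have "card (?F y) = h" using card_secrets y by simp
    then show ?thesis
      using M fin by (simp add: measure_measure_pmf_finite flip: sum_distrib_left)
  qed
  then have "real h * (\<Sum>c\<in>C. pmf (g (restrict (snd c) I)) (fst c)) =
    (\<Sum>c\<in>C. measure_pmf.prob (g (restrict (snd c) I)) (?F (restrict (snd c) I)))"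
    unfolding group by (simp add: sum_distrib_left)
  then show ?thesis
    by (simp add: success_prob_pmf_of_set[OF C] case_prod_beta)
qed

text \<open>
  The average probability of guessing a compatible secret is at most \<open>1\<close>, with equality for the
  strategies that only guess compatible secrets; so the supremum \<open>1 / h\<close> is attained.
\<close>

lemma attack_prob_equidistributed:
  fixes C :: "('s \<times> ('p \<Rightarrow> 'h)) set"
  assumes C: "finite C" "C \<noteq> {}" and P: "i \<le> card P"
    and card_secrets: "\<And>I s x. I \<subseteq> P \<Longrightarrow> card I = i \<Longrightarrow> (s, x) \<in> C \<Longrightarrow>
      card (compatible_secrets C I (restrict x I)) = h"
    and equal: "\<And>I y s s'. I \<subseteq> P \<Longrightarrow> card I = i \<Longrightarrow>
      s \<in> compatible_secrets C I y \<Longrightarrow> s' \<in> compatible_secrets C I y \<Longrightarrow>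
      card {x. (s, x) \<in> C \<and> restrict x I = y} = card {x. (s', x) \<in> C \<and> restrict x I = y}"
  shows "attack_prob (pmf_of_set C) P i = 1 / real h"
proof -
  obtain I where I: "I \<subseteq> P" "card I = i"
    using P obtain_subset_with_card_n by metis
  \<comment> \<open>Any strategy that always names a compatible secret is optimal.\<close>
  define guess where "guess J y = return_pmf (SOME s. s \<in> compatible_secrets C J y)" for J y
  have guess: "measure_pmf.prob (guess J (restrict x J)) (compatible_secrets C J (restrict x J)) = 1"
    if "(s, x) \<in> C" for J s x
  proof -
    have "s \<in> compatible_secrets C J (restrict x J)"
      using that by (auto simp: compatible_secrets_def)
    then have "(SOME s. s \<in> compatible_secrets C J (restrict x J)) \<in> compatible_secrets C J (restrict x J)"
      by (rule someI)
    then show ?thesis by (simp add: guess_def)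
  qed
  have "h > 0"
  proof -
    obtain s x where sx: "(s, x) \<in> C" using C(2) by auto
    have "finite (compatible_secrets C I (restrict x I))"
      using C(1) by (rule finite_surj[of _ _ fst]) (force simp: compatible_secrets_def)
    moreover have "s \<in> compatible_secrets C I (restrict x I)"
      using sx by (auto simp: compatible_secrets_def)
    ultimately show ?thesis
      using card_secrets[OF I sx] by (metis card_gt_0_iff empty_iff)
  qed
  have success: "success_prob (pmf_of_set C) J g =
      (\<Sum>(s, x)\<in>C. measure_pmf.prob (g (restrict x J)) (compatible_secrets C J (restrict x J)))
        / real (card C) / real h"
    if J: "J \<subseteq> P" "card J = i" for J g
  proof -
    have "real h * success_prob (pmf_of_set C) J g =
      (\<Sum>(s, x)\<in>C. measure_pmf.prob (g (restrict x J)) (compatible_secrets C J (restrict x J)))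
        / real (card C)"
    proof (rule success_prob_equidistributed[OF C])
      show "card (compatible_secrets C J (restrict x J)) = h" if "(s, x) \<in> C" for s x
        using card_secrets[OF J that] .
    qed (rule equal[OF J])
    then show ?thesis
      using \<open>h > 0\<close> by (metis nonzero_mult_div_cancel_left of_nat_0_less_iff order_less_irrefl)
  qed
  have card_C: "card C > 0" using C by (simp add: card_gt_0_iff)
  have "success_prob (pmf_of_set C) J g \<le> 1 / real h" if "J \<subseteq> P" "card J = i" for J g
  proof -
    have "(\<Sum>(s, x)\<in>C. measure_pmf.prob (g (restrict x J)) (compatible_secrets C J (restrict x J)))
        \<le> (\<Sum>(s, x)\<in>C. 1)"
      by (intro sum_mono) auto
    then show ?thesis
      unfolding success[OF that] using card_C \<open>h > 0\<close> by (simp add: field_simps)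
  qed
  moreover have "success_prob (pmf_of_set C) I (guess I) = 1 / real h"
  proof -
    have "(\<Sum>(s, x)\<in>C. measure_pmf.prob (guess I (restrict x I)) (compatible_secrets C I (restrict x I)))
        = (\<Sum>(s, x)\<in>C. 1)"
      using guess by (intro sum.cong) auto
    then show ?thesis
      unfolding success[OF I] using card_C by simp
  qed
  ultimately show ?thesis
    unfolding attack_prob_def using I
    by (intro cSup_eq_maximum) (force intro!: image_eqI[of _ _ "(I, guess I)"])+
qed


section \<open>Dealing an arc in a random hyperplane\<close>

lemma arc_choices_image:
  fixes f :: "'a::field ^ 'l::finite \<Rightarrow> 'a ^ 'm::finite"
  assumes lin: "Vector_Spaces.linear (*s) (*s) f" and inj: "inj f"
    and x: "(S, x) \<in> arc_choices n k N d"
  shows "(f ` S, \<lambda>j\<in>{1..N}. f ` x j) \<in> arc_choices n k N d"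
proof -
  let ?y = "\<lambda>j\<in>{1..N}. f ` x j"
  have x': "generalised_arc S (k - 2) (int n) d (x ` {1..N})" "inj_on x {1..N}"
    using x by (simp_all add: arc_choices_def)
  have "?y ` {1..N} = (`) f ` x ` {1..N}"
    by (simp add: image_image)
  then have arc: "generalised_arc (f ` S) (k - 2) (int n) d (?y ` {1..N})"
    using generalised_arc_image[OF lin inj x'(1)] by (simp only:)
  then have "vec.subspace (f ` S)" "pdim (f ` S) = int n"
    by (simp_all add: generalised_arc_def)
  moreover have "inj_on ?y {1..N}"
  proof (rule inj_onI)
    fix i j assume ij: "i \<in> {1..N}" "j \<in> {1..N}" and "?y i = ?y j"
    then have "x i = x j" by (simp add: inj_image_eq_iff[OF inj])
    then show "i = j" using ij by (rule inj_onD[OF x'(2)])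
  qed
  ultimately show ?thesis
    unfolding arc_choices_def mem_Collect_eq prod.case
    by (intro conjI arc restrict_extensional)
qed

lemma finite_arc_choices: "finite (arc_choices n k N d :: (('a::{field,finite} ^ 'm::finite) set \<times> _) set)"
proof (rule finite_subset)
  show "arc_choices n k N d \<subseteq> UNIV \<times> PiE {1..N} (\<lambda>_. UNIV)"
    by (auto simp: arc_choices_def PiE_def)
  show "finite ((UNIV :: ('a ^ 'm) set set) \<times> PiE {1..N} (\<lambda>_. UNIV :: ('a ^ 'm) set set))"
    by (intro finite_cartesian_product finite_PiE) simp_all
qed

text \<open>
  The scheme is defined by a uniform choice, which has the intended meaning only on a nonempty set. An arc
  in \<open>PG(n, q)\<close> is carried into a space of larger dimension by an embedding.
\<close>

lemma arc_choices_nonempty: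
  fixes A :: "('a::{field,finite} ^ 'l::finite) set set"
  assumes l: "CARD('l) = n + 1" and m: "CARD('m::finite) \<ge> n + 1"
    and A: "generalised_arc UNIV (k - 2) (int n) d A"
  shows "(arc_choices n k (card A) d :: (('a ^ 'm) set \<times> _) set) \<noteq> {}"
proof -
  \<comment> \<open>The vectors supported on \<open>J\<close> form a copy of the \<open>n\<close>-dimensional projective space inside the larger one.\<close>
  obtain J :: "'m set" where J: "card J = n + 1"
    using m obtain_subset_with_card_n by metis
  let ?T = "{v :: 'a ^ 'm. \<forall>i. i \<notin> J \<longrightarrow> v $ i = 0}"
  have sub: "vec.subspace ?T"
    by (auto simp: vec.subspace_def)
  have dim: "vec.dim (UNIV :: ('a ^ 'l) set) = vec.dim ?T"
    using J l by (simp only: dim_substandard_cart vec_dim_card)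
  from vec.subspace_isomorphism[OF vec.subspace_UNIV sub dim]
  obtain f :: "'a ^ 'l \<Rightarrow> 'a ^ 'm" where f: "Vector_Spaces.linear (*s) (*s) f" "inj f"
    by (elim exE conjE) (rule that)
  let ?B = "(`) f ` A"
  have B: "generalised_arc (range f) (k - 2) (int n) d ?B"
    using generalised_arc_image[OF f A] .
  have "card ?B = card A"
    by (rule card_image) (simp add: inj_on_def inj_image_eq_iff[OF f(2)])
  then obtain x where x: "bij_betw x {1..card A} ?B"
    using finite_same_card_bij[of "{1..card A}" ?B] by auto
  have "(range f, restrict x {1..card A}) \<in> arc_choices n k (card A) d"
    unfolding arc_choices_def mem_Collect_eq prod.case
  proof (intro conjI)
    show "vec.subspace (range f)" "pdim (range f) = int n"
      using B by (simp_all add: generalised_arc_def)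
    show "inj_on (restrict x {1..card A}) {1..card A}"
      using x by (simp add: bij_betw_def)
    have "restrict x {1..card A} ` {1..card A} = ?B"
      using x unfolding bij_betw_def image_restrict_eq by (rule conjunct2)
    then show "generalised_arc (range f) (k - 2) (int n) d (restrict x {1..card A} ` {1..card A})"
      using B by (simp only:)
  qed (rule restrict_extensional)
  then show ?thesis by blast
qed

lemma arc_parameter_less_top:
  assumes x: "(S, x) \<in> arc_choices n k N d" and i: "i < k" and k: "k \<ge> 2" and d0: "d 0 = -1"
  shows "d i < int n"
proof (cases "i = 0")
  case False
  have "generalised_arc S (k - 2) (int n) d (x ` {1..N})"
    using x by (simp add: arc_choices_def)
  then show ?thesis
    by (rule generalised_arc_less_top) (use False i k in simp_all)
qed (simp add: d0)

text \<open>
  For no shares at all, the span is \<open>{0}\<close>, which accounts for the convention \<open>d 0 = -1\<close>.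
\<close>

lemma pdim_span_shares:
  assumes x: "(S, x) \<in> arc_choices n k N d" and I: "I \<subseteq> {1..N}" "card I < k"
    and k: "k \<ge> 2" and d0: "d 0 = -1"
  shows "pdim (vec.span (\<Union>(x ` I))) = d (card I)"
proof (cases "I = {}")
  case True
  then show ?thesis by (simp add: pdim_def d0)
next
  case False
  then have "card I \<in> {1..k - 2 + 1}"
    using I k finite_subset[OF I(1)] by (auto simp: Suc_le_eq card_gt_0_iff)
  moreover have "card (x ` I) = card I"
    using x I by (auto simp: arc_choices_def intro: card_image inj_on_subset)
  moreover have "x ` I \<subseteq> x ` {1..N}" using I by blast
  ultimately show ?thesis
    using x unfolding arc_choices_def generalised_arc_def by blast
qed

lemma span_shares_subset:
  assumes "(S, x) \<in> arc_choices n k N d" and "I \<subseteq> {1..N}"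
  shows "vec.span (\<Union>(x ` I)) \<subseteq> S"
proof (rule vec.span_minimal)
  have arc: "generalised_arc S (k - 2) (int n) d (x ` {1..N})"
    using assms(1) by (simp add: arc_choices_def)
  then have "\<And>j. j \<in> {1..N} \<Longrightarrow> x j \<subseteq> S"
    by (simp add: generalised_arc_def)
  then show "\<Union>(x ` I) \<subseteq> S"
    using assms(2) by blast
  from arc show "vec.subspace S"
    by (simp add: generalised_arc_def)
qed

text \<open>
  An arc of order \<open>k - 2\<close> is spanned by any \<open>k\<close> of its elements:
  this is how \<open>k\<close> participants reconstruct the secret.
\<close>

lemma span_shares_eq_secret:
  assumes x: "(S, x) \<in> arc_choices n k N d" and I: "I \<subseteq> {1..N}" "card I = k" and k: "k \<ge> 2"
  shows "vec.span (\<Union>(x ` I)) = S"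
proof -
  have "card (x ` I) = card I"
    using x I by (auto simp: arc_choices_def intro: card_image inj_on_subset)
  then have "card (x ` I) = k - 2 + 2"
    using I k by simp
  moreover have "x ` I \<subseteq> x ` {1..N}" using I by blast
  ultimately show ?thesis
    using x unfolding arc_choices_def generalised_arc_def by blast
qed


section \<open>The secrets compatible with given shares\<close>

text \<open>
  The symmetry argument: an automorphism that fixes the known shares and takes \<open>S\<close> to \<open>T\<close> turns the
  arcs in \<open>S\<close> with these shares into arcs in \<open>T\<close> with the same shares. The map \<open>f\<close> is independent of the
  arc \<open>z\<close>, so it can be used to count the completions.
\<close>

lemma move_secret:
  fixes S T :: "('a::field ^ 'm::finite) set"
  assumes x: "(S, x) \<in> arc_choices n k N d" and I: "I \<subseteq> {1..N}"
    and T: "vec.subspace T" "pdim T = int n" "vec.span (\<Union>(x ` I)) \<subseteq> T"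
  shows "\<exists>f. inj f \<and> (\<forall>z. (S, z) \<in> arc_choices n k N d \<and> restrict z I = restrict x I \<longrightarrow>
    (T, \<lambda>j\<in>{1..N}. f ` z j) \<in> arc_choices n k N d \<and>
    restrict (\<lambda>j\<in>{1..N}. f ` z j) I = restrict x I)"
proof -
  have S: "vec.subspace S" "pdim S = int n"
    using x by (auto simp: arc_choices_def)
  have "vec.dim S = vec.dim T"
    using S(2) T(2) by (simp add: pdim_def)
  then obtain f where f: "Vector_Spaces.linear (*s) (*s) f" "inj f"
      "\<And>u. u \<in> vec.span (\<Union>(x ` I)) \<Longrightarrow> f u = u" "f ` S = T"
    using linear_automorphism_fixing_subspace[OF vec.subspace_span S(1) T(1) span_shares_subset[OF x I] T(3)]
    by metis
  have "(T, \<lambda>j\<in>{1..N}. f ` z j) \<in> arc_choices n k N d \<and>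
      restrict (\<lambda>j\<in>{1..N}. f ` z j) I = restrict x I"
    if z: "(S, z) \<in> arc_choices n k N d" "restrict z I = restrict x I" for z
  proof
    show "(T, \<lambda>j\<in>{1..N}. f ` z j) \<in> arc_choices n k N d"
      using arc_choices_image[OF f(1,2) z(1)] f(4) by simp
    have "f ` z j = x j" if "j \<in> I" for j
    proof -
      have "z j = x j" using z(2) that by (metis restrict_apply')
      moreover have "x j \<subseteq> vec.span (\<Union>(x ` I))"
        using that by (meson UN_upper order_trans vec.span_superset)
      then have "f ` x j = x j" using f(3) by (force simp: image_def)
      ultimately show ?thesis by simp
    qed
    then show "restrict (\<lambda>j\<in>{1..N}. f ` z j) I = restrict x I"
      using I by (auto simp: restrict_def fun_eq_iff)
  qed
  with f(2) show ?thesis by blast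
qed

text \<open>
  Moving the actual arc into another hyperplane above the known shares shows that the coalition cannot
  exclude any of these hyperplanes.
\<close>

lemma compatible_arc_secrets:
  fixes S :: "('a::field ^ 'm::finite) set"
  assumes x: "(S, x) \<in> arc_choices n k N d" and I: "I \<subseteq> {1..N}"
  shows "compatible_secrets (arc_choices n k N d) I (restrict x I) =
    {T. vec.subspace T \<and> pdim T = int n \<and> vec.span (\<Union>(x ` I)) \<subseteq> T}"
proof (intro equalityI subsetI)
  fix T assume "T \<in> compatible_secrets (arc_choices n k N d) I (restrict x I)"
  then obtain z where z: "(T, z) \<in> arc_choices n k N d" "restrict z I = restrict x I"
    by (auto simp: compatible_secrets_def)
  have "z ` I = x ` I"
    using z(2) by (metis image_restrict_eq)
  then show "T \<in> {T. vec.subspace T \<and> pdim T = int n \<and> vec.span (\<Union>(x ` I)) \<subseteq> T}"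
    using span_shares_subset[OF z(1) I] z(1) by (simp add: arc_choices_def)
next
  fix T assume "T \<in> {T. vec.subspace T \<and> pdim T = int n \<and> vec.span (\<Union>(x ` I)) \<subseteq> T}"
  then have T: "vec.subspace T" "pdim T = int n" "vec.span (\<Union>(x ` I)) \<subseteq> T"
    by simp_all
  obtain f where "inj f" and f: "\<And>z. (S, z) \<in> arc_choices n k N d \<Longrightarrow> restrict z I = restrict x I \<Longrightarrow>
      (T, \<lambda>j\<in>{1..N}. f ` z j) \<in> arc_choices n k N d \<and>
      restrict (\<lambda>j\<in>{1..N}. f ` z j) I = restrict x I"
    using move_secret[OF x I T] by blast
  from f[OF x refl] show "T \<in> compatible_secrets (arc_choices n k N d) I (restrict x I)"
    by (auto simp: compatible_secrets_def)
qed

text \<open>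
  As \<open>S\<close> and \<open>T\<close> can be exchanged, the two cardinalities are equal:
  the posterior distribution of the secret is uniform.
\<close>

lemma card_completions_le:
  fixes S T :: "('a::{field,finite} ^ 'm::finite) set"
  assumes I: "I \<subseteq> {1..N}"
    and S: "S \<in> compatible_secrets (arc_choices n k N d) I y"
    and T: "T \<in> compatible_secrets (arc_choices n k N d) I y"
  shows "card {x. (S, x) \<in> arc_choices n k N d \<and> restrict x I = y}
    \<le> card {x. (T, x) \<in> arc_choices n k N d \<and> restrict x I = y}"
proof -
  obtain x where x: "(S, x) \<in> arc_choices n k N d" "restrict x I = y"
    using S by (auto simp: compatible_secrets_def)
  have T': "vec.subspace T" "pdim T = int n" "vec.span (\<Union>(x ` I)) \<subseteq> T"
    using T compatible_arc_secrets[OF x(1) I] x(2) by auto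
  obtain f where f: "inj f" "\<And>z. (S, z) \<in> arc_choices n k N d \<Longrightarrow> restrict z I = restrict x I \<Longrightarrow>
      (T, \<lambda>j\<in>{1..N}. f ` z j) \<in> arc_choices n k N d \<and>
      restrict (\<lambda>j\<in>{1..N}. f ` z j) I = restrict x I"
    using move_secret[OF x(1) I T'] by blast
  show ?thesis
  proof (rule card_inj_on_le[where f = "\<lambda>z. \<lambda>j\<in>{1..N}. f ` z j"])
    show "(\<lambda>z. \<lambda>j\<in>{1..N}. f ` z j) ` {x. (S, x) \<in> arc_choices n k N d \<and> restrict x I = y}
        \<subseteq> {x. (T, x) \<in> arc_choices n k N d \<and> restrict x I = y}"
      using f(2) x(2) by auto
    show "finite {x. (T, x) \<in> arc_choices n k N d \<and> restrict x I = y}"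
      using finite_arc_choices[of n k N d]
      by (rule finite_surj[of _ _ snd]) force
    show "inj_on (\<lambda>z. \<lambda>j\<in>{1..N}. f ` z j) {x. (S, x) \<in> arc_choices n k N d \<and> restrict x I = y}"
    proof (rule inj_onI)
      fix z z' assume z: "z \<in> {x. (S, x) \<in> arc_choices n k N d \<and> restrict x I = y}"
        "z' \<in> {x. (S, x) \<in> arc_choices n k N d \<and> restrict x I = y}"
        and eq: "(\<lambda>j\<in>{1..N}. f ` z j) = (\<lambda>j\<in>{1..N}. f ` z' j)"
      have "z j = z' j" if "j \<in> {1..N}" for j
        using fun_cong[OF eq, of j] that by (simp add: inj_image_eq_iff[OF f(1)])
      moreover have "z \<in> extensional {1..N}" "z' \<in> extensional {1..N}"
        using z by (auto simp: arc_choices_def)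
      ultimately show "z = z'" by (rule extensionalityI[rotated 2])
    qed
  qed
qed

lemma card_compatible_arc_secrets:
  fixes S :: "('a::{field,finite} ^ 'm::finite) set"
  assumes m: "CARD('m) = n + 2" and k: "k \<ge> 2" and d0: "d 0 = -1"
    and x: "(S, x) \<in> arc_choices n k N d" and I: "I \<subseteq> {1..N}" "card I < k"
  shows "card (compatible_secrets (arc_choices n k N d) I (restrict x I)) * (CARD('a) - 1)
    = CARD('a) ^ nat (int n + 1 - d (card I)) - 1"
proof -
  let ?U = "vec.span (\<Union>(x ` I))"
  have "vec.dim ?U \<le> vec.dim S"
    using span_shares_subset[OF x I(1)] by (rule vec.dim_subset)
  also have "vec.dim S = n + 1"
    using x by (auto simp: arc_choices_def pdim_def)
  finally have "vec.dim ?U < CARD('m)" using m by simp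
  then have "CARD('m) - vec.dim ?U = nat (int n + 1 - pdim ?U)"
    using m unfolding pdim_def by linarith
  moreover have "pdim T = int n \<longleftrightarrow> vec.dim T = CARD('m) - 1" for T :: "('a ^ 'm) set"
    using m by (auto simp: pdim_def)
  ultimately show ?thesis
    unfolding compatible_arc_secrets[OF x I(1)] pdim_span_shares[OF x I k d0, symmetric]
    using card_hyperplanes_above[OF vec.subspace_span \<open>vec.dim ?U < CARD('m)\<close>] by simp
qed


section \<open>Reconstruction and attack probabilities\<close>

text \<open>
  Fewer than \<open>k\<close> participants fail because their shares lie in at least \<open>q + 1\<close> hyperplanes, each of which
  is the secret for some arc with the same shares.
\<close>

lemma arc_scheme_is_secret_sharing:
  fixes D :: "(('a::{field,finite} ^ 'm::finite) set \<times> (nat \<Rightarrow> ('a ^ 'm) set)) pmf"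
  assumes m: "CARD('m) = n + 2" and k: "k \<ge> 2" and d0: "d 0 = -1"
    and nonempty: "(arc_choices n k N d :: (('a ^ 'm) set \<times> _) set) \<noteq> {}"
    and D: "D = arc_scheme n k N d"
  shows "secret_sharing_scheme k N {1..N} D"
proof -
  define C :: "(('a ^ 'm) set \<times> (nat \<Rightarrow> ('a ^ 'm) set)) set" where "C = arc_choices n k N d"
  have set_D: "set_pmf D = C"
    unfolding D arc_scheme_def C_def using nonempty finite_arc_choices by (rule set_pmf_of_set)
  show ?thesis
    unfolding secret_sharing_scheme_def set_D
  proof (intro conjI allI impI)
    fix I assume I: "I \<subseteq> {1..N}" "card I = k"
    show "\<exists>f. \<forall>(s, x)\<in>C. f (restrict x I) = s"
    proof (intro exI[of _ "\<lambda>y. vec.span (\<Union>(y ` I))"] ballI, clarify)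
      fix s x assume "(s, x) \<in> C"
      then show "vec.span (\<Union>(restrict x I ` I)) = s"
        using span_shares_eq_secret[OF _ I k] by (simp add: C_def)
    qed
  next
    fix I assume I: "I \<subseteq> {1..N}" "card I < k"
    show "\<forall>(s, x)\<in>C. \<exists>(s', x')\<in>C. restrict x' I = restrict x I \<and> s' \<noteq> s"
    proof clarify
      fix s x assume sx: "(s, x) \<in> C"
      let ?F = "compatible_secrets C I (restrict x I)"
      let ?q = "CARD('a)"
      have "\<not> ?F \<subseteq> {s}"
      proof
        assume "?F \<subseteq> {s}"
        then have "card ?F \<le> 1" using card_mono[of "{s}" ?F] by simp
        then have "?q ^ nat (int n + 1 - d (card I)) - 1 \<le> ?q - 1"
          unfolding card_compatible_arc_secrets[OF m k d0 sx[unfolded C_def] I, symmetric] C_def by simp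
        moreover have "?q ^ 1 < ?q ^ nat (int n + 1 - d (card I))"
          \<comment> \<open>Fewer than \<open>k\<close> shares span at most dimension \<open>n - 1\<close>, so the exponent is at least \<open>2\<close>.\<close>
          using card_field_ge_2[where 'a = 'a] arc_parameter_less_top[OF sx[unfolded C_def] I(2) k d0]
          by (intro power_strict_increasing) auto
        ultimately show False using card_field_ge_2[where 'a = 'a] by simp
      qed
      then show "\<exists>(s', x')\<in>C. restrict x' I = restrict x I \<and> s' \<noteq> s"
        by (auto simp: compatible_secrets_def)
    qed
  qed auto
qed

text \<open>
  Given the shares of a coalition, the secret is uniformly distributed among the hyperplanes above their span,
  so the attack probability is the inverse of their number.
\<close>

lemma attack_prob_arc_scheme:
  fixes D :: "(('a::{field,finite} ^ 'm::finite) set \<times> (nat \<Rightarrow> ('a ^ 'm) set)) pmf"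
  assumes m: "CARD('m) = n + 2" and k: "k \<ge> 2" and d0: "d 0 = -1"
    and nonempty: "(arc_choices n k N d :: (('a ^ 'm) set \<times> _) set) \<noteq> {}"
    and D: "D = arc_scheme n k N d"
    and i: "i < k" "i \<le> N"
  shows "attack_prob D {1..N} i =
    (real CARD('a) - 1) / (real CARD('a) powi (int n + 1 - d i) - 1)"
proof -
  define C :: "(('a ^ 'm) set \<times> (nat \<Rightarrow> ('a ^ 'm) set)) set" where "C = arc_choices n k N d"
  have C: "finite C" "C \<noteq> {}"
    unfolding C_def using finite_arc_choices nonempty by blast+
  define q where "q = CARD('a)"
  have q: "q \<ge> 2" unfolding q_def by (rule card_field_ge_2)
  \<comment> \<open>The number of hyperplanes above the span of \<open>i\<close> shares.\<close>
  define h where "h = (q ^ nat (int n + 1 - d i) - 1) div (q - 1)"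
  have card: "card (compatible_secrets C I (restrict x I)) * (q - 1) = q ^ nat (int n + 1 - d i) - 1"
    if "I \<subseteq> {1..N}" "card I = i" "(s, x) \<in> C" for I s x
    using card_compatible_arc_secrets[OF m k d0 that(3)[unfolded C_def] that(1)] that(2) i(1)
    by (simp add: C_def q_def)
  have card_h: "card (compatible_secrets C I (restrict x I)) = h"
    if "I \<subseteq> {1..N}" "card I = i" "(s, x) \<in> C" for I s x
    unfolding h_def card[OF that, symmetric] using q by simp
  obtain S x where sx: "(S, x) \<in> C" using C(2) by auto
  have "{1..i} \<subseteq> {1..N}" "card {1..i} = i"
    using i(2) by auto
  then have h: "h * (q - 1) = q ^ nat (int n + 1 - d i) - 1"
    using card card_h sx by metis
  have "attack_prob D {1..N} i = 1 / real h"
    unfolding D arc_scheme_def C_def[symmetric]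
  proof (rule attack_prob_equidistributed[OF C])
    show "i \<le> card {1..N}" using i by simp
    show "card (compatible_secrets C I (restrict x I)) = h"
      if "I \<subseteq> {1..N}" "card I = i" "(s, x) \<in> C" for I s x
      using that by (rule card_h)
    show "card {x. (s, x) \<in> C \<and> restrict x I = y} = card {x. (s', x) \<in> C \<and> restrict x I = y}"
      if "I \<subseteq> {1..N}" "s \<in> compatible_secrets C I y" "s' \<in> compatible_secrets C I y" for I y s s'
      using that unfolding C_def by (intro antisym card_completions_le)
  qed
  moreover have "real h * (real q - 1) = real q powi (int n + 1 - d i) - 1"
  proof -
    have "real h * (real q - 1) = real (h * (q - 1))"
      using q by (simp add: of_nat_diff)
    also have "\<dots> = real q ^ nat (int n + 1 - d i) - 1"
      unfolding h using q by (simp add: of_nat_diff)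
    finally show ?thesis
      using arc_parameter_less_top[OF sx[unfolded C_def] i(1) k d0] by (simp add: power_int_def)
  qed
  moreover have "real q - 1 \<noteq> 0" using q by simp
  ultimately show ?thesis
    unfolding q_def by (metis mult.commute nonzero_divide_mult_cancel_left)
qed

theorem theorem8:
  fixes q n k N :: nat
    and d :: "nat \<Rightarrow> int"
    and D :: "(('a::{field,finite} ^ 'm::finite) set \<times> (nat \<Rightarrow> ('a ^ 'm) set)) pmf"
  assumes "CARD('a) = q"
    and "CARD('l::finite) = n + 1"
    and "CARD('m) = n + 2"
    and "k \<ge> 2" and "N \<ge> k" and "n > 0"
    and "d 0 = -1"
    and "\<exists>A :: ('a ^ 'l) set set. generalised_arc UNIV (k - 2) (int n) d A \<and> card A = N"
    and "D = arc_scheme n k N d"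
  shows "secret_sharing_scheme k N {1..N} D \<and>
    (\<forall>i<k. attack_prob D {1..N} i = (real q - 1) / (real q powi (int n + 1 - d i) - 1))"
proof -
  obtain A :: "('a ^ 'l) set set" where A: "generalised_arc UNIV (k - 2) (int n) d A" "card A = N"
    using assms(8) by blast
  have nonempty: "(arc_choices n k N d :: (('a ^ 'm) set \<times> _) set) \<noteq> {}"
    using arc_choices_nonempty[where 'm = 'm, OF assms(2) _ A(1)] A(2) assms(3) by simp
  have "attack_prob D {1..N} i = (real q - 1) / (real q powi (int n + 1 - d i) - 1)" if "i < k" for i
    using attack_prob_arc_scheme[OF assms(3,4,7) nonempty assms(9) that] that assms(1,5) by simp
  with arc_scheme_is_secret_sharing[OF assms(3,4,7) nonempty assms(9)] show ?thesis
    by blast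
qed

end
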